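(* Let $n\ge 1$ and let $L_1,\dots,L_{2n+1}$ be $2n+1$ concurrent lines in the complex projective plane $\mathbb{P}^2$ meeting a smooth conic $D$ in $4n+2$ distinct points. Put $L_{2n+1+j}=L_j$ for $1\le j\le 2n+1$. Take any point $P_1$ on $L_1$ and draw a tangent line $t_1$ to $D$ from $P_1$; it cuts $L_2$ in one point $P_2$. Continue successively: for $2\le i\le 4n+1$ let $t_i$ be the second tangent line to $D$ from $P_i$ (the one other than $t_{i-1}$) and let $P_{i+1}$ be the intersection point of $t_i$ with $L_{i+1}$. This gives points $P_i\in L_i$ for $1\le i\le 2n+1$ and $P_{2n+1+j}\in L_j$ for $1\le j\le 2n+1$. Then the line $(P_1P_{4n+2})$ (defined whenever $P_1\ne P_{4n+2}$) is tangent to $D$.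
   Context: For a point $P\notin D$ there are exactly two tangent lines to $D$ through $P$; for $P\in D$ the two tangents are understood to coincide with the tangent line to $D$ at $P$, so the "second tangent" from $P$ is again this line. *)

theory Defs
  imports "HOL-Analysis.Analysis"
begin

text \<open>The complex projective plane is the set of one-dimensional subspaces of \<open>complex ^ 3\<close>, and
  its lines are the two-dimensional subspaces. A point \<open>p\<close> lies on a line \<open>l\<close> iff \<open>p \<subseteq> l\<close>, and the
  intersection point of two distinct lines is the subspace \<open>l \<inter> m\<close>.\<close>

definition proj_points :: "(complex ^ 3) set set" where
  "proj_points = {p. vec.subspace p \<and> vec.dim p = 1}"

definition proj_lines :: "(complex ^ 3) set set" where
  "proj_lines = {l. vec.subspace l \<and> vec.dim l = 2}"

definition line_through :: "(complex ^ 3) set \<Rightarrow> (complex ^ 3) set \<Rightarrow> (complex ^ 3) set" where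
  "line_through p q = vec.span (p \<union> q)"

definition quad_form :: "complex ^ 3 ^ 3 \<Rightarrow> complex ^ 3 \<Rightarrow> complex" where
  "quad_form A v = (\<Sum>i\<in>UNIV. \<Sum>j\<in>UNIV. A $ i $ j * v $ i * v $ j)"

text \<open>\<open>A\<close> need not be symmetric. The components of \<open>quad_grad A v\<close> are the partial derivatives of
  \<open>quad_form A\<close> at \<open>v\<close>, as checked in \<open>quad_form_partial\<close>.\<close>

definition quad_grad :: "complex ^ 3 ^ 3 \<Rightarrow> complex ^ 3 \<Rightarrow> complex ^ 3" where
  "quad_grad A v = (\<chi> i. \<Sum>j\<in>UNIV. (A $ i $ j + A $ j $ i) * v $ j)"

lemma quad_form_partial:
  "((\<lambda>s. quad_form A (v + s *s axis i 1)) has_field_derivative quad_grad A v $ i) (at 0)"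
proof -
  have "i = 1 \<or> i = 2 \<or> i = 3" using exhaust_3 by blast
  then show ?thesis
    unfolding quad_form_def quad_grad_def
    by (elim disjE) (auto simp: sum_3 axis_def algebra_simps intro!: derivative_eq_intros)
qed

definition conic_points :: "complex ^ 3 ^ 3 \<Rightarrow> (complex ^ 3) set set" where
  "conic_points A = {p \<in> proj_points. \<forall>v\<in>p. quad_form A v = 0}"

definition smooth_conic :: "complex ^ 3 ^ 3 \<Rightarrow> bool" where
  "smooth_conic A \<longleftrightarrow> (\<forall>v. v \<noteq> 0 \<and> quad_form A v = 0 \<longrightarrow> quad_grad A v \<noteq> 0)"

definition tangent_at :: "complex ^ 3 ^ 3 \<Rightarrow> (complex ^ 3) set \<Rightarrow> (complex ^ 3) set" where
  "tangent_at A p = {w. \<forall>v\<in>p. (\<Sum>i\<in>UNIV. quad_grad A v $ i * w $ i) = 0}"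

definition tangent_line :: "complex ^ 3 ^ 3 \<Rightarrow> (complex ^ 3) set \<Rightarrow> bool" where
  "tangent_line A t \<longleftrightarrow> (\<exists>p\<in>conic_points A. t = tangent_at A p)"

text \<open>The tangent from \<open>p\<close> other than \<open>t\<close>; for a point of the conic both tangents are understood to
  be the tangent line at that point.\<close>

definition second_tangent ::
    "complex ^ 3 ^ 3 \<Rightarrow> (complex ^ 3) set \<Rightarrow> (complex ^ 3) set \<Rightarrow> (complex ^ 3) set" where
  "second_tangent A p t =
    (if p \<in> conic_points A then tangent_at A p
     else (THE t'. tangent_line A t' \<and> p \<subseteq> t' \<and> t' \<noteq> t))"

end

theory Submission
  imports Defs
begin

text \<open>
  Let \<open>B\<close> be the symmetric bilinear form with \<open>B v v = 2 * quad_form A v\<close>. The tangents to \<open>D\<close> are the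
  polar lines \<open>{w. B x w = 0}\<close> of the isotropic vectors \<open>x \<noteq> 0\<close>, so the sequence of tangents \<open>t i\<close>
  can be followed through the points of contact.

  Having \<open>4 * n + 2\<close> points of \<open>D\<close> on the \<open>2 * n + 1\<close> lines forces each line to meet \<open>D\<close> twice, and
  no point of \<open>D\<close> to lie on all lines. Hence the common point \<open>c\<close> is not on \<open>D\<close> and no \<open>L i\<close> is a
  tangent (\<open>maximal_pencil\<close>). Let \<open>e\<close> and \<open>f\<close> be the points of contact of the two tangents through
  \<open>c\<close>. In suitably scaled coordinates \<open>X e + Y f + Z c\<close> the conic is \<open>X Y = Z\<^sup>2\<close> and every line
  through \<open>c\<close> other than those two tangents is \<open>X = m Y\<close> with \<open>m \<noteq> 0\<close>
  (\<open>nontangent_line_is_mirror\<close>).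

  The linear map \<open>(X, Y, Z) \<mapsto> (m Y, X / m, Z)\<close> preserves \<open>B\<close> and fixes that line pointwise, so it
  permutes the tangents through each point of the line. If the point is off \<open>D\<close>, then the two
  tangents are interchanged; if it is on \<open>D\<close>, then the one tangent is kept
  (\<open>second_tangent_reflect\<close>). Passing from \<open>t (i - 1)\<close> to \<open>t i\<close> therefore applies this reflection
  to the point of contact.

  On the plane \<open>Z = 0\<close> these reflections have determinant \<open>-1\<close>, so a product of an odd number of them
  is again such a reflection, hence an involution (\<open>odd_fold_reflect_involution\<close>). Let \<open>x0\<close> be the
  reflection of the point of contact of \<open>t 1\<close> in \<open>L 1\<close>, so that the polar line of \<open>x0\<close> is the other
  tangent through \<open>P 1\<close>. Going twice around the \<open>2 * n + 1\<close> lines from \<open>x0\<close> applies one involution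
  twice and returns to \<open>x0\<close>. So the second tangent from \<open>P (4 * n + 2)\<close> is the polar line of \<open>x0\<close>,
  which also passes through \<open>P 1\<close>.
\<close>

section \<open>Points and lines as spans\<close>

lemma span_pair: "vec.span {u, v :: complex ^ 3} = {w. \<exists>a b. w = a *s u + b *s v}"
proof -
  have "w \<in> vec.span {u, v} \<longleftrightarrow> (\<exists>a b. w = a *s u + b *s v)" for w
  proof -
    have "w \<in> vec.span {u, v} \<longleftrightarrow> (\<exists>a b. w - a *s u = b *s v)"
      by (auto simp: vec.span_breakdown_eq[of w u "{v}"] vec.span_singleton)
    also have "\<dots> \<longleftrightarrow> (\<exists>a b. w = a *s u + b *s v)"
      by (simp add: diff_eq_eq add.commute)
    finally show ?thesis .
  qed
  then show ?thesis by blast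
qed

lemma proj_pointsE:
  assumes "p \<in> proj_points"
  obtains v where "v \<noteq> 0" "p = vec.span {v}"
proof -
  have sub: "vec.subspace p" and dim: "vec.dim p = 1"
    using assms by (auto simp: proj_points_def)
  have "\<not> p \<subseteq> {0}" using dim vec.dim_eq_0[of p] by simp
  then obtain v where v: "v \<in> p" "v \<noteq> 0" by blast
  have "vec.span {v} = p"
    using v sub dim
    by (intro vec.subspace_dim_equal) (auto simp: vec.span_minimal)
  with v(2) that show ?thesis by blast
qed

lemma span_in_proj_points: "v \<noteq> 0 \<Longrightarrow> vec.span {v} \<in> proj_points"
  by (simp add: proj_points_def)

lemma span_singleton_subset_iff: "vec.subspace S \<Longrightarrow> vec.span {v} \<subseteq> S \<longleftrightarrow> v \<in> S"
  using vec.span_minimal[of "{v}" S] vec.span_base[of v "{v}"] by blast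

lemma span_singleton_eqI:
  assumes "y \<in> vec.span {x}" "y \<noteq> 0"
  shows "vec.span {y} = vec.span {x :: complex ^ 3}"
  using assms
  by (intro vec.subspace_dim_equal) (auto simp: span_singleton_subset_iff)

lemma span_three_UNIV:
  fixes u v w :: "complex ^ 3"
  assumes "u \<noteq> 0" "v \<notin> vec.span {u}" "w \<notin> vec.span {v, u}"
  shows "vec.span {w, v, u} = UNIV"
proof -
  have "vec.dim {w, v, u} = 3"
    using assms by (simp add: vec.dim_insert)
  then have "vec.dim (UNIV :: (complex ^ 3) set) \<le> vec.dim (vec.span {w, v, u})"
    using vec_dim_card[where 'a = complex and 'n = 3] by simp
  then show ?thesis by (intro vec.subspace_dim_equal) auto
qed

lemma not_spanned_by_two:
  obtains w where "w \<notin> vec.span {v, u :: complex ^ 3}"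
proof -
  have "vec.dim (vec.span {v, u}) \<le> 2"
    using vec.dim_le_card[of "{v,u}" "{v,u}"] by (simp add: vec.dim_insert)
  moreover have "vec.dim (UNIV :: (complex ^ 3) set) = 3"
    using vec_dim_card[where 'a = complex and 'n = 3] by simp
  ultimately have "vec.span {v, u} \<noteq> UNIV" by force
  with that show ?thesis by blast
qed

lemma proj_line_eq_span:
  assumes "l \<in> proj_lines" "u \<in> l" "u \<noteq> 0"
  obtains v where "v \<notin> vec.span {u}" "l = vec.span {u, v}"
proof -
  have sub: "vec.subspace l" and dim: "vec.dim l = 2"
    using assms by (auto simp: proj_lines_def)
  have "\<not> l \<subseteq> vec.span {u}"
    using dim vec.dim_subset[of l "vec.span {u}"] assms(3) by auto
  then obtain v where v: "v \<in> l" "v \<notin> vec.span {u}" by blast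
  have "vec.dim {v, u} = 2" using v(2) assms(3) by (simp add: vec.dim_insert)
  then have "vec.span {v, u} = l"
    using v assms(2) sub dim
    by (intro vec.subspace_dim_equal) (auto simp: vec.span_minimal)
  then show ?thesis using that v(2) by (simp add: insert_commute)
qed

lemma scale_in_spanD:
  assumes "b *s v \<in> vec.span S" "b \<noteq> 0"
  shows "(v :: complex ^ 3) \<in> vec.span S"
  using vec.span_scale[OF assms(1), of "inverse b"] assms(2) by (simp add: vec.scale_scale)

section \<open>The polar form of a conic\<close>

definition polar :: "complex ^ 3 ^ 3 \<Rightarrow> complex ^ 3 \<Rightarrow> complex ^ 3 \<Rightarrow> complex" where
  "polar A v w = (\<Sum>i\<in>UNIV. quad_grad A v $ i * w $ i)"

text \<open>The polar of the point \<open>v\<close>: for a point of the conic, the tangent there.\<close>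

definition polar_line :: "complex ^ 3 ^ 3 \<Rightarrow> complex ^ 3 \<Rightarrow> (complex ^ 3) set" where
  "polar_line A v = {w. polar A v w = 0}"

lemma polar_linear [simp]:
  "polar A (u + v) w = polar A u w + polar A v w"
  "polar A u (v + w) = polar A u v + polar A u w"
  "polar A (u - v) w = polar A u w - polar A v w"
  "polar A u (v - w) = polar A u v - polar A u w"
  "polar A (a *s u) w = a * polar A u w"
  "polar A u (a *s w) = a * polar A u w"
  "polar A 0 w = 0"
  "polar A u 0 = 0"
  by (simp_all add: polar_def quad_grad_def sum_3 algebra_simps)

lemma polar_commute: "polar A v w = polar A w v"
  by (simp add: polar_def quad_grad_def sum_3 algebra_simps)

lemma polar_self: "polar A v v = 2 * quad_form A v"
  by (simp add: polar_def quad_grad_def quad_form_def sum_3 algebra_simps)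

lemma quad_form_eq_0_iff: "quad_form A v = 0 \<longleftrightarrow> polar A v v = 0"
  by (simp add: polar_self)

lemma subspace_polar_line: "vec.subspace (polar_line A v)"
  by (auto simp: vec.subspace_def polar_line_def)

lemma span_subset_polar_line: "(\<And>w. w \<in> S \<Longrightarrow> polar A v w = 0) \<Longrightarrow> vec.span S \<subseteq> polar_line A v"
  by (intro vec.span_minimal subspace_polar_line) (auto simp: polar_line_def)

lemma polar_nondegenerate:
  assumes "smooth_conic A" "\<And>w. polar A v w = 0"
  shows "v = 0"
proof (rule ccontr)
  assume "v \<noteq> 0"
  moreover have "quad_form A v = 0" using assms(2) by (simp add: quad_form_eq_0_iff)
  ultimately have "quad_grad A v \<noteq> 0" using assms(1) by (simp add: smooth_conic_def)
  moreover have "quad_grad A v $ i = 0" for i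
    using assms(2)[of "axis i 1"] by (simp add: polar_def axis_def if_distrib cong: if_cong)
  ultimately show False by (simp add: vec_eq_iff)
qed

lemma polar_nondegenerate_spanning:
  assumes "smooth_conic A" "vec.span S = UNIV" "\<And>w. w \<in> S \<Longrightarrow> polar A v w = 0"
  shows "v = 0"
proof (rule polar_nondegenerate[OF assms(1)])
  have "vec.span S \<subseteq> polar_line A v"
    using assms(3) by (rule span_subset_polar_line)
  then show "polar A v w = 0" for w using assms(2) by (auto simp: polar_line_def)
qed

lemma conic_points_iff: "p \<in> conic_points A \<longleftrightarrow> (\<exists>x. x \<noteq> 0 \<and> polar A x x = 0 \<and> p = vec.span {x})"
proof
  assume p: "p \<in> conic_points A"
  then obtain x where x: "x \<noteq> 0" "p = vec.span {x}"
    by (auto simp: conic_points_def elim: proj_pointsE)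
  moreover have "x \<in> p" using x by (simp add: vec.span_base)
  ultimately show "\<exists>x. x \<noteq> 0 \<and> polar A x x = 0 \<and> p = vec.span {x}"
    using p by (auto simp: conic_points_def quad_form_eq_0_iff)
next
  assume "\<exists>x. x \<noteq> 0 \<and> polar A x x = 0 \<and> p = vec.span {x}"
  then obtain x where x: "x \<noteq> 0" "polar A x x = 0" "p = vec.span {x}" by blast
  have "quad_form A v = 0" if "v \<in> p" for v
    using that x by (auto simp: quad_form_eq_0_iff vec.span_singleton)
  then show "p \<in> conic_points A"
    using x by (simp add: conic_points_def span_in_proj_points)
qed

lemma tangent_at_span: "tangent_at A (vec.span {x}) = polar_line A x"
proof -
  have "tangent_at A (vec.span {x}) = {w. \<forall>v \<in> vec.span {x}. polar A v w = 0}"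
    by (simp add: tangent_at_def polar_def)
  also have "\<dots> = polar_line A x"
    using vec.span_base[of x "{x}"] by (auto simp: vec.span_singleton polar_line_def)
  finally show ?thesis .
qed

lemma tangent_line_iff: "tangent_line A t \<longleftrightarrow> (\<exists>x. x \<noteq> 0 \<and> polar A x x = 0 \<and> t = polar_line A x)"
  unfolding tangent_line_def Bex_def conic_points_iff using tangent_at_span by blast

text \<open>A tangent meets the conic only at its point of contact. Otherwise \<open>x\<close> and \<open>y\<close> span a totally
  isotropic plane. Both are orthogonal to that plane, and a suitable combination of them is orthogonal
  to a third basis vector too, which contradicts nondegeneracy.\<close>

lemma isotropic_orthogonal_imp_parallel:
  assumes "smooth_conic A" "x \<noteq> 0" "polar A x x = 0" "polar A y y = 0" "polar A x y = 0"
  shows "y \<in> vec.span {x}"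
proof (rule ccontr)
  assume y: "y \<notin> vec.span {x}"
  obtain w where w: "w \<notin> vec.span {y, x}" by (rule not_spanned_by_two)
  have span: "vec.span {w, y, x} = UNIV" by (rule span_three_UNIV[OF assms(2) y w])
  have "polar A y w *s x - polar A x w *s y = 0"
    by (rule polar_nondegenerate_spanning[OF assms(1) span])
       (use assms in \<open>auto simp: polar_commute[of A y x]\<close>)
  then have eq: "polar A x w *s y = polar A y w *s x" by simp
  have "polar A x w = 0"
  proof (rule ccontr)
    assume "polar A x w \<noteq> 0"
    then have "y = (polar A y w / polar A x w) *s x"
      using arg_cong[OF eq, of "\<lambda>v. inverse (polar A x w) *s v"]
      by (simp add: vec.scale_scale field_simps)
    with y show False by (auto simp: vec.span_singleton)
  qed
  then have "x = 0"
    by (intro polar_nondegenerate_spanning[OF assms(1) span]) (use assms in auto)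
  with assms(2) show False by simp
qed

lemma line_through_eq_polar_line:
  assumes "smooth_conic A" "x \<noteq> 0" "p \<in> proj_points" "q \<in> proj_points" "p \<noteq> q"
    and "p \<subseteq> polar_line A x" "q \<subseteq> polar_line A x"
  shows "line_through p q = polar_line A x"
proof -
  obtain u where u: "u \<noteq> 0" "p = vec.span {u}" using assms(3) by (rule proj_pointsE)
  obtain v where v: "v \<noteq> 0" "q = vec.span {v}" using assms(4) by (rule proj_pointsE)
  have "v \<notin> vec.span {u}" using assms(5) u v span_singleton_eqI by blast
  then have "vec.dim {v, u} = 2" using u(1) by (simp add: vec.dim_insert)
  moreover have "{v, u} \<subseteq> line_through p q"
    using u(2) v(2) by (auto simp: line_through_def intro!: vec.span_base)
  ultimately have "vec.dim (line_through p q) \<ge> 2" using vec.dim_subset by metis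
  moreover have "vec.dim (polar_line A x) \<le> 2"
  proof (rule ccontr)
    assume "\<not> vec.dim (polar_line A x) \<le> 2"
    then have "vec.dim (UNIV :: (complex ^ 3) set) \<le> vec.dim (polar_line A x)"
      using vec_dim_card[where 'a = complex and 'n = 3] by simp
    then have "polar_line A x = UNIV"
      by (intro vec.subspace_dim_equal) (auto simp: subspace_polar_line)
    then have "polar A x w = 0" for w by (auto simp: polar_line_def)
    with polar_nondegenerate[OF assms(1)] assms(2) show False by blast
  qed
  moreover have "line_through p q \<subseteq> polar_line A x"
    unfolding line_through_def using assms(6,7)
    by (intro vec.span_minimal subspace_polar_line) auto
  ultimately show ?thesis
    by (intro vec.subspace_dim_equal) (auto simp: line_through_def subspace_polar_line)
qed

section \<open>Counting the points of the conic on a line\<close>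

definition conic_on :: "complex ^ 3 ^ 3 \<Rightarrow> (complex ^ 3) set \<Rightarrow> (complex ^ 3) set set" where
  "conic_on A l = {p \<in> conic_points A. p \<subseteq> l}"

lemma conic_on_tangent:
  assumes "smooth_conic A" "x \<noteq> 0" "polar A x x = 0" "l \<subseteq> polar_line A x"
  shows "conic_on A l \<subseteq> {vec.span {x}}"
proof
  fix p assume p: "p \<in> conic_on A l"
  then obtain y where y: "y \<noteq> 0" "polar A y y = 0" "p = vec.span {y}"
    by (auto simp: conic_on_def conic_points_iff)
  have "y \<in> l" using p y(3) vec.span_base[of y "{y}"] by (auto simp: conic_on_def)
  then have "y \<in> vec.span {x}"
    using assms y(2) by (intro isotropic_orthogonal_imp_parallel) (auto simp: polar_line_def)
  with y show "p \<in> {vec.span {x}}" by (simp add: span_singleton_eqI)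
qed

text \<open>On the line spanned by two of its points \<open>x\<close> and \<open>y\<close>, the equation of the conic becomes
  \<open>a * b * polar A x y = 0\<close> in the coordinates \<open>a *s y + b *s x\<close>, and \<open>polar A x y \<noteq> 0\<close>.\<close>

lemma conic_on_subset_pair:
  assumes "smooth_conic A" "l \<in> proj_lines" "p \<in> conic_on A l"
  obtains q where "conic_on A l \<subseteq> {p, q}"
proof (cases "conic_on A l \<subseteq> {p}")
  case True
  then show ?thesis using that by blast
next
  case False
  then obtain q where q: "q \<in> conic_on A l" "q \<noteq> p" by blast
  obtain x where x: "x \<noteq> 0" "polar A x x = 0" "p = vec.span {x}"
    using assms(3) by (auto simp: conic_on_def conic_points_iff)
  obtain y where y: "y \<noteq> 0" "polar A y y = 0" "q = vec.span {y}"
    using q(1) by (auto simp: conic_on_def conic_points_iff)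
  have xl: "x \<in> l" and yl: "y \<in> l"
    using assms(3) q(1) x(3) y(3) vec.span_base[of x "{x}"] vec.span_base[of y "{y}"]
    by (auto simp: conic_on_def)
  have y_notin: "y \<notin> vec.span {x}" using q(2) x(3) y(1,3) span_singleton_eqI by blast
  then have xy: "polar A x y \<noteq> 0"
    using isotropic_orthogonal_imp_parallel[OF assms(1) x(1,2) y(2)] by blast
  have sub: "vec.subspace l" and dim: "vec.dim l = 2"
    using assms(2) by (auto simp: proj_lines_def)
  have "vec.dim {y, x} = 2" using y_notin x(1) by (simp add: vec.dim_insert)
  then have l: "vec.span {y, x} = l"
    using xl yl sub dim by (intro vec.subspace_dim_equal) (auto simp: vec.span_minimal)
  have "r \<in> {p, q}" if r: "r \<in> conic_on A l" for r
  proof -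
    obtain z where z: "z \<noteq> 0" "polar A z z = 0" "r = vec.span {z}"
      using r by (auto simp: conic_on_def conic_points_iff)
    have "z \<in> vec.span {y, x}"
      using r z(3) vec.span_base[of z "{z}"] l by (auto simp: conic_on_def)
    then obtain a b where ab: "z = a *s y + b *s x" by (auto simp: span_pair)
    have "2 * a * b * polar A x y = 0"
      using z(2) x(2) y(2) by (simp add: ab polar_commute[of A y x] algebra_simps)
    with xy have "a = 0 \<or> b = 0" by simp
    then have "z \<in> vec.span {x} \<or> z \<in> vec.span {y}" by (auto simp: ab vec.span_singleton)
    with z(1,3) x(3) y(3) show ?thesis using span_singleton_eqI by blast
  qed
  with that show ?thesis by blast
qed

lemma conic_on_card_le_2:
  assumes "smooth_conic A" "l \<in> proj_lines"
  shows "finite (conic_on A l) \<and> card (conic_on A l) \<le> 2"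
proof (cases "conic_on A l = {}")
  case False
  then obtain p where "p \<in> conic_on A l" by blast
  then obtain q where q: "conic_on A l \<subseteq> {p, q}"
    by (rule conic_on_subset_pair[OF assms])
  have "card (conic_on A l) \<le> card {p, q}" by (rule card_mono) (use q in auto)
  also have "\<dots> \<le> 2" by (simp add: card_insert_if)
  finally show ?thesis using q finite_subset by auto
qed simp

text \<open>The union attains the bound \<open>2 * card I\<close>, which leaves no room for a set with fewer than two
  elements; in the next lemma, none for an element counted in every set.\<close>

lemma maximal_union_imp_no_singleton:
  assumes "finite I" "\<And>i. i \<in> I \<Longrightarrow> finite (S i) \<and> card (S i) \<le> 2"
    and "card (\<Union>i\<in>I. S i) = 2 * card I" "j \<in> I"
  shows "\<not> S j \<subseteq> {a}"
proof
  assume "S j \<subseteq> {a}"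
  then have j: "card (S j) \<le> 1" using card_mono[of "{a}" "S j"] by simp
  have "card (\<Union>i\<in>I. S i) \<le> (\<Sum>i\<in>I. card (S i))" by (rule card_UN_le[OF assms(1)])
  also have "\<dots> = card (S j) + (\<Sum>i\<in>I - {j}. card (S i))"
    by (rule sum.remove[OF assms(1,4)])
  also have "(\<Sum>i\<in>I - {j}. card (S i)) \<le> card (I - {j}) * 2"
    using sum_bounded_above[of "I - {j}" "\<lambda>i. card (S i)" 2] assms(2) by simp
  finally show False
    using assms(3) j card.remove[OF assms(1,4)] by linarith
qed

lemma maximal_union_imp_no_common_point:
  assumes "finite I" "card I \<ge> 2" "\<And>i. i \<in> I \<Longrightarrow> finite (S i) \<and> card (S i) \<le> 2"
    and "card (\<Union>i\<in>I. S i) = 2 * card I"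
  shows "\<exists>j\<in>I. a \<notin> S j"
proof (rule ccontr)
  assume "\<not> (\<exists>j\<in>I. a \<notin> S j)"
  then have a: "a \<in> S i" if "i \<in> I" for i using that by blast
  have "(\<Union>i\<in>I. S i) \<subseteq> insert a (\<Union>i\<in>I. S i - {a})" by blast
  then have "card (\<Union>i\<in>I. S i) \<le> card (insert a (\<Union>i\<in>I. S i - {a}))"
    by (rule card_mono[rotated]) (use assms(1,3) in auto)
  also have "\<dots> \<le> Suc (card (\<Union>i\<in>I. S i - {a}))" by (rule card_insert_le_m1) auto
  also have "card (\<Union>i\<in>I. S i - {a}) \<le> (\<Sum>i\<in>I. card (S i - {a}))" by (rule card_UN_le[OF assms(1)])
  also have "\<dots> \<le> card I * 1"
    using sum_bounded_above[of I "\<lambda>i. card (S i - {a})" 1] a assms(3)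
    by (fastforce simp: card_Diff_singleton)
  finally show False using assms(2,4) by simp
qed

text \<open>If \<open>c\<close> were on the conic, it would be a common element of all the sets of conic points; a tangent
  would contribute a single point. Either would make the union too small.\<close>

lemma maximal_pencil:
  assumes "smooth_conic A" "finite I" "card I \<ge> 2" "\<forall>i\<in>I. L i \<in> proj_lines"
    and "\<forall>i\<in>I. c \<in> L i" "c \<noteq> 0"
    and "card (\<Union>i\<in>I. conic_on A (L i)) = 2 * card I"
  shows "polar A c c \<noteq> 0"
    and "\<And>i x. i \<in> I \<Longrightarrow> x \<noteq> 0 \<Longrightarrow> polar A x x = 0 \<Longrightarrow> \<not> L i \<subseteq> polar_line A x"
proof -
  have le2: "finite (conic_on A (L i)) \<and> card (conic_on A (L i)) \<le> 2" if "i \<in> I" for i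
    using conic_on_card_le_2 assms(1,4) that by blast
  obtain j where j: "j \<in> I" "vec.span {c} \<notin> conic_on A (L j)"
    using maximal_union_imp_no_common_point[OF assms(2,3) le2 assms(7)] by blast
  have "vec.span {c} \<subseteq> L j"
    using assms(4,5) j(1) by (auto simp: proj_lines_def span_singleton_subset_iff)
  with j(2) assms(6) show "polar A c c \<noteq> 0" by (auto simp: conic_on_def conic_points_iff)
  fix i x assume i: "i \<in> I" and x: "x \<noteq> 0" "polar A x x = 0"
  have "\<not> conic_on A (L i) \<subseteq> {vec.span {x}}"
    by (rule maximal_union_imp_no_singleton[OF assms(2) _ assms(7) i]) (rule le2)
  then show "\<not> L i \<subseteq> polar_line A x"
    using conic_on_tangent[OF assms(1) x] by blast
qed

section \<open>Frames\<close>

text \<open>The three vectors are a basis, so by nondegeneracy a vector is determined by its products with them,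
  and the Gram matrix gives the coefficients. The second use of this, besides the fixed frame below, is
  to show that only two tangents pass through a point \<open>c\<close> off the conic: a point of contact \<open>v\<close> has
  \<open>polar A c v = 0\<close> and is isotropic, so one of the two other coefficients vanishes.\<close>

lemma frame_expansion:
  assumes "smooth_conic A"
    and "polar A e e = 0" "polar A f f = 0" "polar A e c = 0" "polar A f c = 0"
    and "polar A e f \<noteq> 0" "polar A c c \<noteq> 0"
  shows "v = (polar A f v / polar A e f) *s e + (polar A e v / polar A e f) *s f
              + (polar A c v / polar A c c) *s c" (is "v = ?w")
proof -
  have comm: "polar A f e = polar A e f" "polar A c e = 0" "polar A c f = 0"
    using assms by (simp_all add: polar_commute[of A f e] polar_commute[of A c e] polar_commute[of A c f])
  have "c \<noteq> 0" using assms(7) by auto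
  moreover have "f \<notin> vec.span {c}"
    using assms(4,6) span_subset_polar_line[of "{c}" A e] by (auto simp: polar_line_def)
  moreover have "e \<notin> vec.span {f, c}"
    using assms(3,5,6) comm(1) span_subset_polar_line[of "{f, c}" A f]
    by (fastforce simp: polar_line_def)
  ultimately have span: "vec.span {e, f, c} = UNIV" by (rule span_three_UNIV)
  have "v - ?w = 0"
    using assms comm
    by (intro polar_nondegenerate_spanning[OF assms(1) span])
       (auto simp: polar_commute[of A v e] polar_commute[of A v f] polar_commute[of A v c])
  then show ?thesis by simp
qed

text \<open>The scaling makes the conic \<open>X Y = Z\<^sup>2\<close> for the coordinates \<open>X *s e + Y *s f + Z *s c\<close>, where
  \<open>X = polar A f v\<close>, \<open>Y = polar A e v\<close> and \<open>Z = - polar A c v / 2\<close>.\<close>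

locale polar_frame =
  fixes A :: "complex ^ 3 ^ 3" and e f c :: "complex ^ 3"
  assumes smooth: "smooth_conic A"
    and frame_e: "polar A e e = 0" and frame_f: "polar A f f = 0"
    and frame_ec: "polar A e c = 0" and frame_fc: "polar A f c = 0"
    and frame_ef: "polar A e f = 1" and frame_c: "polar A c c = - 2"

text \<open>A binary quadratic form over the complex numbers has a nontrivial zero.\<close>

lemma isotropic_combination:
  obtains a b where "a \<noteq> 0 \<or> b \<noteq> 0" "polar A (a *s u + b *s v) (a *s u + b *s v) = 0"
proof (cases "polar A u u = 0")
  case True
  then show ?thesis using that[of 1 0] by simp
next
  case False
  define p q r where "p = polar A u u" and "q = polar A u v" and "r = polar A v v"
  have "p \<noteq> 0" using False by (simp add: p_def)
  define s where "s = csqrt (q\<^sup>2 - p * r)"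
  have s: "s * s = q * q - p * r"
    using power2_csqrt[of "q\<^sup>2 - p * r"] by (simp add: s_def power2_eq_square)
  \<comment> \<open>The pair \<open>(s - q, p)\<close> is a zero of the form \<open>p a\<^sup>2 + 2 q a b + r b\<^sup>2\<close>, by the quadratic formula.\<close>
  define a where "a = s - q"
  have "polar A (a *s u + p *s v) (a *s u + p *s v) = p * (a * a + 2 * q * a + p * r)"
    by (simp add: polar_commute[of A v u] p_def q_def r_def algebra_simps)
  also have "a * a + 2 * q * a + p * r = s * s - q * q + p * r"
    by (simp add: a_def algebra_simps)
  finally show ?thesis using that[of a p] \<open>p \<noteq> 0\<close> s by simp
qed

text \<open>A tangent through a point off the conic exists: the projections of two further basis vectors to the
  orthogonal complement of \<open>c\<close> are independent, and some combination of them is isotropic.\<close>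

lemma isotropic_orthogonal_exists:
  assumes "polar A c c \<noteq> 0"
  obtains e where "e \<noteq> 0" "polar A e e = 0" "polar A c e = 0"
proof -
  define proj where "proj v = v - (polar A c v / polar A c c) *s c" for v
  have proj_orth: "polar A c (proj v) = 0" for v using assms by (simp add: proj_def)
  obtain u where u: "u \<notin> vec.span {c, c}" by (rule not_spanned_by_two)
  obtain v where v: "v \<notin> vec.span {u, c}" by (rule not_spanned_by_two)
  obtain a b where ab: "a \<noteq> 0 \<or> b \<noteq> 0"
    "polar A (a *s proj u + b *s proj v) (a *s proj u + b *s proj v) = 0"
    by (rule isotropic_combination)
  define e where "e = a *s proj u + b *s proj v"
  have "e \<noteq> 0"
  proof
    assume "e = 0"
    define g where "g = a * (polar A c u / polar A c c) + b * (polar A c v / polar A c c)"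
    have "e = a *s u + b *s v - g *s c"
      by (simp add: e_def proj_def g_def vec_eq_iff algebra_simps)
    with \<open>e = 0\<close> have g: "a *s u + b *s v = g *s c" by simp
    have "b = 0"
    proof (rule ccontr)
      assume b: "b \<noteq> 0"
      have "b *s v = (- a) *s u + g *s c" using g[symmetric] by simp
      then have "b *s v \<in> vec.span {u, c}" unfolding span_pair by blast
      with b v show False using scale_in_spanD by blast
    qed
    with ab(1) have a: "a \<noteq> 0" by simp
    have "a *s u \<in> vec.span {c, c}" using g \<open>b = 0\<close> by (auto simp: vec.span_singleton)
    with a u show False using scale_in_spanD by blast
  qed
  moreover have "polar A e e = 0" "polar A c e = 0"
    using ab(2) by (simp_all only: e_def) (simp add: proj_orth)
  ultimately show ?thesis using that by blast
qed

text \<open>In a nondegenerate plane an isotropic vector \<open>e\<close> has an isotropic partner: take any \<open>w\<close> in the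
  plane that is not orthogonal to \<open>e\<close> and subtract the multiple of \<open>e\<close> that makes it isotropic.\<close>

lemma polar_frame_exists:
  assumes "smooth_conic A" "polar A c c \<noteq> 0"
  obtains e f k where "k \<noteq> 0" "polar_frame A e f (k *s c)"
proof -
  obtain e where e: "e \<noteq> 0" "polar A e e = 0" "polar A c e = 0"
    using isotropic_orthogonal_exists[OF assms(2)] by blast
  have ec: "polar A e c = 0" using e(3) by (simp add: polar_commute[of A e c])
  obtain w0 where w0: "polar A e w0 \<noteq> 0" using polar_nondegenerate[OF assms(1)] e(1) by blast
  \<comment> \<open>Project \<open>w0\<close> to the orthogonal complement of \<open>c\<close>; this does not change its product with \<open>e\<close>.\<close>
  define w where "w = w0 - (polar A c w0 / polar A c c) *s c"
  have cw: "polar A c w = 0" using assms(2) by (simp add: w_def)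
  have ew: "polar A e w \<noteq> 0" using w0 by (simp add: w_def ec)
  define f where "f = inverse (polar A e w) *s (w - (polar A w w / (2 * polar A e w)) *s e)"
  have ef: "polar A e f = 1" using ew by (simp add: f_def e(2))
  have "polar A w w - polar A w w / (2 * polar A e w) * polar A e w
      - polar A w w / (2 * polar A e w) * polar A e w = 0"
    using ew by (simp add: field_simps)
  then have ff: "polar A f f = 0"
    by (simp add: f_def e(2) polar_commute[of A w e])
  have fc: "polar A f c = 0"
    by (simp add: f_def ec polar_commute[of A w c] cw)
  define k where "k = csqrt (- 2 / polar A c c)"
  have k: "k * k = - 2 / polar A c c"
    using power2_csqrt[of "- 2 / polar A c c"] by (simp add: k_def power2_eq_square)
  have "k \<noteq> 0" using k assms(2) by auto
  moreover have "polar A (k *s c) (k *s c) = - 2"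
    using k assms(2) by (simp add: mult.assoc[symmetric])
  then have "polar_frame A e f (k *s c)"
    by unfold_locales (simp_all add: assms(1) e(2) ec ef ff fc)
  ultimately show ?thesis using that by blast
qed

section \<open>Reflections\<close>

context polar_frame
begin

definition mirror :: "complex \<Rightarrow> (complex ^ 3) set" where
  "mirror m = {w. polar A f w = m * polar A e w}"

text \<open>For \<open>m \<noteq> 0\<close>, the orthogonal reflection in the plane \<open>mirror m\<close>, which is \<open>X = m Y\<close>.\<close>

definition reflect :: "complex \<Rightarrow> complex ^ 3 \<Rightarrow> complex ^ 3" where
  "reflect m v = (m * polar A e v) *s e + (polar A f v / m) *s f - (polar A c v / 2) *s c"

lemma frame_commuted [simp]: "polar A f e = 1" "polar A c e = 0" "polar A c f = 0"
  using frame_ef frame_ec frame_fc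
  by (simp_all add: polar_commute[of A f e] polar_commute[of A c e] polar_commute[of A c f])

lemmas frame_simps [simp] = frame_e frame_f frame_ec frame_fc frame_ef frame_c

lemma expansion: "v = polar A f v *s e + polar A e v *s f - (polar A c v / 2) *s c"
proof -
  have "v = (polar A f v / polar A e f) *s e + (polar A e v / polar A e f) *s f
              + (polar A c v / polar A c c) *s c"
    by (rule frame_expansion) (simp_all add: smooth)
  also have "\<dots> = polar A f v *s e + polar A e v *s f - (polar A c v / 2) *s c"
    by (simp add: vec_eq_iff)
  finally show ?thesis .
qed

lemma coordinates_eqI:
  assumes "polar A e v = polar A e w" "polar A f v = polar A f w" "polar A c v = polar A c w"
  shows "v = w"
  using expansion[of v] expansion[of w] assms by simp

lemma polar_coordinates:
  "polar A v w = polar A f v * polar A e w + polar A e v * polar A f w - polar A c v * polar A c w / 2"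
proof -
  have "polar A v w = polar A (polar A f v *s e + polar A e v *s f - (polar A c v / 2) *s c) w"
    using expansion[of v] by simp
  then show ?thesis by simp
qed

lemma reflect_coordinates [simp]:
  "polar A f (reflect m v) = m * polar A e v"
  "polar A e (reflect m v) = polar A f v / m"
  "polar A c (reflect m v) = polar A c v"
  by (simp_all add: reflect_def)

lemma polar_reflect: "m \<noteq> 0 \<Longrightarrow> polar A (reflect m v) (reflect m w) = polar A v w"
  by (simp add: polar_coordinates[of v] polar_coordinates[of "reflect m v"])

lemma reflect_reflect: "m \<noteq> 0 \<Longrightarrow> reflect m (reflect m v) = v"
  by (rule coordinates_eqI) simp_all

lemma reflect_eq_0_iff: "m \<noteq> 0 \<Longrightarrow> reflect m v = 0 \<longleftrightarrow> v = 0"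
  by (metis polar_linear(8) reflect_reflect reflect_coordinates coordinates_eqI mult_zero_right div_0)

lemma reflect_mirror: "m \<noteq> 0 \<Longrightarrow> v \<in> mirror m \<Longrightarrow> reflect m v = v"
  by (rule coordinates_eqI) (simp_all add: mirror_def)

lemma polar_reflect_mirror: "m \<noteq> 0 \<Longrightarrow> v \<in> mirror m \<Longrightarrow> polar A (reflect m x) v = polar A x v"
  using polar_reflect[of m x v] reflect_mirror[of m v] by simp

lemma subspace_mirror: "vec.subspace (mirror m)"
  by (auto simp: vec.subspace_def mirror_def algebra_simps)

text \<open>By \<open>X Y = Z\<^sup>2\<close> this product is a perfect square, up to a factor. Its vanishing says that \<open>x\<close> lies
  on the mirror, so a point of the conic off the mirror is not parallel to its reflection.\<close>

lemma polar_reflect_self: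
  assumes "m \<noteq> 0" "polar A x x = 0"
  shows "polar A x (reflect m x) = (polar A f x - m * polar A e x)\<^sup>2 / m"
proof -
  have "polar A c x * polar A c x / 2 = 2 * polar A f x * polar A e x"
    using assms(2) polar_coordinates[of x x] by (simp add: mult.commute)
  then have "polar A x (reflect m x) = polar A f x * (polar A f x / m) + polar A e x * (m * polar A e x)
      - 2 * polar A f x * polar A e x"
    by (subst polar_coordinates) simp
  also have "\<dots> = (polar A f x - m * polar A e x)\<^sup>2 / m"
    using assms(1) by (simp add: field_simps power2_eq_square)
  finally show ?thesis .
qed

text \<open>The excluded tangents that matter are those at \<open>e\<close> and \<open>f\<close>, the lines \<open>Y = 0\<close> and \<open>X = 0\<close>;
  every other line through \<open>c\<close> is \<open>X = m Y\<close> with a finite nonzero \<open>m\<close>.\<close>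

lemma nontangent_line_is_mirror:
  assumes "l \<in> proj_lines" "c \<in> l"
    and "\<And>x. x \<noteq> 0 \<Longrightarrow> polar A x x = 0 \<Longrightarrow> \<not> l \<subseteq> polar_line A x"
  obtains m where "m \<noteq> 0" "l = mirror m"
proof -
  have "c \<noteq> 0" using frame_c by (auto simp del: frame_simps)
  have "e \<noteq> 0" using frame_ef by (auto simp del: frame_simps)
  have "f \<noteq> 0" using frame_ef by (auto simp del: frame_simps)
  obtain d where d: "d \<notin> vec.span {c}" "l = vec.span {c, d}"
    by (rule proj_line_eq_span[OF assms(1,2) \<open>c \<noteq> 0\<close>])
  have "\<not> l \<subseteq> polar_line A e" "\<not> l \<subseteq> polar_line A f"
    using assms(3) \<open>e \<noteq> 0\<close> \<open>f \<noteq> 0\<close> by simp_all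
  then have ed: "polar A e d \<noteq> 0" and fd: "polar A f d \<noteq> 0"
    using span_subset_polar_line[of "{c, d}" A e] span_subset_polar_line[of "{c, d}" A f]
    by (force simp: d(2))+
  define m where "m = polar A f d / polar A e d"
  have "l = mirror m"
  proof
    show "l \<subseteq> mirror m"
      unfolding d(2) using ed
      by (intro vec.span_minimal subspace_mirror) (auto simp: mirror_def m_def)
    show "mirror m \<subseteq> l"
    proof
      fix w assume "w \<in> mirror m"
      then have w: "polar A f w = m * polar A e w" by (simp add: mirror_def)
      define r where "r = polar A e w / polar A e d"
      have "w = ((r * polar A c d - polar A c w) / 2) *s c + r *s d"
        by (rule coordinates_eqI) (use ed w in \<open>simp_all add: r_def m_def field_simps\<close>)
      then show "w \<in> l" unfolding d(2) span_pair by blast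
    qed
  qed
  moreover have "m \<noteq> 0" using ed fd by (simp add: m_def)
  ultimately show ?thesis using that by blast
qed

text \<open>On the mirror, the equation of the tangent reads \<open>2 * h * Y = g * polar A c w\<close> with \<open>g\<close> and \<open>h\<close>
  as below. Only if both vanish could the mirror lie inside the tangent, and then \<open>x = 0\<close>.\<close>

lemma tangent_meets_mirror:
  assumes "m \<noteq> 0" "x \<noteq> 0" "polar A x x = 0"
  shows "polar_line A x \<inter> mirror m \<in> proj_points"
proof -
  define g h where "g = polar A c x" and "h = polar A f x + m * polar A e x"
  have gh: "g \<noteq> 0 \<or> h \<noteq> 0"
  proof (rule ccontr)
    assume "\<not> (g \<noteq> 0 \<or> h \<noteq> 0)"
    then have c: "polar A c x = 0" and f: "polar A f x = - m * polar A e x"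
      by (simp_all add: g_def h_def eq_neg_iff_add_eq_0)
    have "m * (polar A e x * polar A e x) = 0"
      using assms(3) polar_coordinates[of x x] c f by simp
    then have "x = 0" using assms(1) c f by (intro coordinates_eqI) simp_all
    with assms(2) show False by simp
  qed
  have mem: "w \<in> polar_line A x \<inter> mirror m \<longleftrightarrow>
      polar A f w = m * polar A e w \<and> 2 * (h * polar A e w) = g * polar A c w" for w
    by (auto simp: polar_line_def mirror_def polar_coordinates[of x w] g_def h_def algebra_simps)
  \<comment> \<open>The solution of that equation, up to scaling: \<open>Y = g\<close> and \<open>polar A c v = 2 * h\<close>.\<close>
  define v where "v = (m * g) *s e + g *s f - h *s c"
  have v: "polar A e v = g" "polar A f v = m * g" "polar A c v = 2 * h"
    by (simp_all add: v_def)
  have "v \<noteq> 0" using v gh by auto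
  moreover have "polar_line A x \<inter> mirror m = vec.span {v}"
  proof
    show "vec.span {v} \<subseteq> polar_line A x \<inter> mirror m"
      using mem[of v] v
      by (simp add: span_singleton_subset_iff vec.subspace_inter subspace_polar_line subspace_mirror)
    show "polar_line A x \<inter> mirror m \<subseteq> vec.span {v}"
    proof
      fix w assume "w \<in> polar_line A x \<inter> mirror m"
      then have w: "polar A f w = m * polar A e w" "2 * (h * polar A e w) = g * polar A c w"
        using mem by auto
      define k where "k = (if g = 0 then polar A c w / (2 * h) else polar A e w / g)"
      have "w = k *s v"
        by (rule coordinates_eqI) (use w v gh in \<open>auto simp: k_def field_simps\<close>)
      then show "w \<in> vec.span {v}" by (auto simp: vec.span_singleton)
    qed
  qed
  ultimately show ?thesis by (simp add: span_in_proj_points)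
qed

lemma mirror_point_on_reflect_tangent:
  assumes "m \<noteq> 0" "p \<subseteq> mirror m" "p \<subseteq> polar_line A x"
  shows "p \<subseteq> polar_line A (reflect m x)"
proof
  fix w assume "w \<in> p"
  then have "w \<in> mirror m" "polar A x w = 0" using assms by (auto simp: polar_line_def)
  then show "w \<in> polar_line A (reflect m x)"
    using assms(1) by (simp add: polar_line_def polar_reflect_mirror)
qed

lemma polar_line_scale: "k \<noteq> 0 \<Longrightarrow> polar_line A (k *s x) = polar_line A x"
  by (simp add: polar_line_def)

text \<open>The reflected tangent passes through \<open>p\<close> because the mirror is fixed pointwise. If \<open>p\<close> is on the
  conic, then the tangent is the one at \<open>p\<close>, and \<open>x\<close> is itself on the mirror. If \<open>p\<close> is off the
  conic, then \<open>x\<close> is not on the mirror, as \<open>p\<close> is the only point of the tangent there; so the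
  reflected tangent is a different one, and there is no third tangent through \<open>p\<close>.\<close>

lemma second_tangent_reflect:
  assumes m: "m \<noteq> 0" and x: "x \<noteq> 0" "polar A x x = 0"
    and p: "p \<in> proj_points" "p \<subseteq> mirror m" "p \<subseteq> polar_line A x"
  shows "second_tangent A p (polar_line A x) = polar_line A (reflect m x)"
proof -
  obtain v where v: "v \<noteq> 0" "p = vec.span {v}" using p(1) by (rule proj_pointsE)
  have "v \<in> p" using v(2) by (simp add: vec.span_base)
  then have vM: "v \<in> mirror m" and xv: "polar A x v = 0" using p by (auto simp: polar_line_def)
  show ?thesis
  proof (cases "polar A v v = 0")
    case True
    have "v \<in> vec.span {x}"
      by (rule isotropic_orthogonal_imp_parallel[OF smooth x True xv])
    then obtain k where k: "v = k *s x" by (auto simp: vec.span_singleton)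
    with v(1) have "k \<noteq> 0" by auto
    have "x = inverse k *s v" using k \<open>k \<noteq> 0\<close> by (simp add: vec.scale_scale)
    then have "x \<in> mirror m" using vM vec.subspace_scale[OF subspace_mirror] by simp
    then have "reflect m x = x" using m reflect_mirror by simp
    moreover have "p \<in> conic_points A" using v True by (auto simp: conic_points_iff)
    ultimately show ?thesis
      using \<open>k \<noteq> 0\<close> by (simp add: second_tangent_def v(2) tangent_at_span k polar_line_scale)
  next
    case False
    define x' where "x' = reflect m x"
    have x': "x' \<noteq> 0" "polar A x' x' = 0" "polar A x' v = 0"
      using m x vM xv by (simp_all add: x'_def reflect_eq_0_iff polar_reflect polar_reflect_mirror)
    have xx': "polar A x x' \<noteq> 0"
    proof
      assume "polar A x x' = 0"
      then have "x \<in> mirror m" using polar_reflect_self[OF m x(2)] m by (simp add: x'_def mirror_def)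
      then have xin: "x \<in> polar_line A x \<inter> mirror m" and vin: "v \<in> polar_line A x \<inter> mirror m"
        using x xv vM by (simp_all add: polar_line_def)
      obtain u where u: "polar_line A x \<inter> mirror m = vec.span {u}"
        using tangent_meets_mirror[OF m x] by (rule proj_pointsE)
      have "v \<in> vec.span {x}"
        using vin xin x(1) unfolding u by (metis span_singleton_eqI)
      then have "polar A v v = 0" using x(2) by (auto simp: vec.span_singleton)
      with False show False by simp
    qed
    have "p \<notin> conic_points A"
    proof
      assume "p \<in> conic_points A"
      then have "quad_form A v = 0" using \<open>v \<in> p\<close> by (simp add: conic_points_def)
      with False show False by (simp add: quad_form_eq_0_iff)
    qed
    moreover have "(THE t'. tangent_line A t' \<and> p \<subseteq> t' \<and> t' \<noteq> polar_line A x) = polar_line A x'"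
    proof (rule the_equality)
      have "x' \<notin> polar_line A x" "x' \<in> polar_line A x'"
        using xx' x'(2) by (simp_all add: polar_line_def)
      then show "tangent_line A (polar_line A x') \<and> p \<subseteq> polar_line A x' \<and> polar_line A x' \<noteq> polar_line A x"
        using x' mirror_point_on_reflect_tangent[OF m p(2,3)] by (auto simp: tangent_line_iff x'_def)
    next
      fix t' assume t': "tangent_line A t' \<and> p \<subseteq> t' \<and> t' \<noteq> polar_line A x"
      then obtain y where y: "y \<noteq> 0" "polar A y y = 0" "t' = polar_line A y"
        by (auto simp: tangent_line_iff)
      have vy: "polar A v y = 0"
        using t' y(3) \<open>v \<in> p\<close> by (auto simp: polar_line_def polar_commute[of A v y])
      define a b where "a = polar A x' y / polar A x x'" and "b = polar A x y / polar A x x'"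
      have y_eq: "y = a *s x + b *s x'"
        using frame_expansion[OF smooth x(2) x'(2) xv x'(3) xx' False, of y] vy
        by (simp add: a_def b_def)
      have "2 * a * b * polar A x x' = 0"
        using y(2) x(2) x'(2) by (simp add: y_eq polar_commute[of A x' x] algebra_simps)
      with xx' consider "a = 0" | "b = 0" by auto
      then show "t' = polar_line A x'"
      proof cases
        case 1
        with y y_eq show ?thesis using polar_line_scale[of b x'] by auto
      next
        case 2
        with y y_eq t' show ?thesis using polar_line_scale[of a x] by auto
      qed
    qed
    ultimately show ?thesis by (simp add: second_tangent_def x'_def)
  qed
qed

text \<open>The product of the reflections with parameters \<open>k\<close> and \<open>l\<close> is the diagonal map
  \<open>(X, Y, Z) \<mapsto> (r X, Y / r, Z)\<close> with \<open>r = k / l\<close>. Writing diagonal maps in the form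
  \<open>reflect r (reflect 1 v)\<close> keeps the even case within the same family of maps.\<close>

lemma fold_reflect:
  assumes "0 \<notin> set ms"
  shows "\<exists>k. k \<noteq> 0 \<and> (\<forall>v. fold reflect ms v = (if even (length ms) then reflect k (reflect 1 v) else reflect k v))"
  using assms
proof (induction ms rule: rev_induct)
  case Nil
  then show ?case by (intro exI[of _ 1]) (simp add: reflect_reflect)
next
  case (snoc m ms)
  then obtain k where k: "k \<noteq> 0"
    "\<And>v. fold reflect ms v = (if even (length ms) then reflect k (reflect 1 v) else reflect k v)" by auto
  have m: "m \<noteq> 0" using snoc.prems by auto
  have "reflect m (reflect k (reflect 1 v)) = reflect (m / k) v" "reflect m (reflect k v) = reflect (m / k) (reflect 1 v)" for v
    by (rule coordinates_eqI; use m k(1) in \<open>simp add: field_simps\<close>)+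
  then show ?case using m k by (intro exI[of _ "m / k"]) simp
qed

lemma odd_fold_reflect_involution:
  assumes "0 \<notin> set ms" "odd (length ms)"
  shows "fold reflect ms (fold reflect ms v) = v"
proof -
  obtain k where k: "k \<noteq> 0"
    "\<forall>v. fold reflect ms v = (if even (length ms) then reflect k (reflect 1 v) else reflect k v)"
    using fold_reflect[of ms] assms(1) by blast
  then have "fold reflect ms v = reflect k v" for v using assms(2) by simp
  with k(1) show ?thesis by (simp add: reflect_reflect)
qed

lemma fold_reflect_isotropic:
  assumes "0 \<notin> set ms" "x \<noteq> 0" "polar A x x = 0"
  shows "fold reflect ms x \<noteq> 0 \<and> polar A (fold reflect ms x) (fold reflect ms x) = 0"
  using assms by (induction ms rule: rev_induct) (auto simp: reflect_eq_0_iff polar_reflect)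

end

section \<open>The closing theorem\<close>

theorem proposition2p9:
  fixes n :: nat
    and A :: "complex ^ 3 ^ 3"
    and L P t :: "nat \<Rightarrow> (complex ^ 3) set"
  assumes "n \<ge> 1"
    and "smooth_conic A"
    and "\<And>i. i \<in> {1..2*n+1} \<Longrightarrow> L i \<in> proj_lines"
    and "\<exists>c\<in>proj_points. \<forall>i\<in>{1..2*n+1}. c \<subseteq> L i"
    and "card (\<Union>i\<in>{1..2*n+1}. {p \<in> conic_points A. p \<subseteq> L i}) = 4*n+2"
    and "\<And>j. j \<in> {1..2*n+1} \<Longrightarrow> L (2*n+1+j) = L j"
    and "P 1 \<in> proj_points" and "P 1 \<subseteq> L 1"
    and "tangent_line A (t 1)" and "P 1 \<subseteq> t 1"
    and "\<And>i. i \<in> {2..4*n+1} \<Longrightarrow> t i = second_tangent A (P i) (t (i - 1))"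
    and "\<And>i. i \<in> {1..4*n+1} \<Longrightarrow> P (i + 1) = t i \<inter> L (i + 1)"
  shows "(\<forall>i\<in>{1..4*n+2}. P i \<in> proj_points) \<and>
         (\<forall>j\<in>{1..2*n+1}. P j \<subseteq> L j \<and> P (2*n+1+j) \<subseteq> L j) \<and>
         (P 1 \<noteq> P (4*n+2) \<longrightarrow> tangent_line A (line_through (P 1) (P (4*n+2))))"
proof -
  obtain c' where c': "c' \<noteq> 0" "\<And>i. i \<in> {1..2*n+1} \<Longrightarrow> vec.span {c'} \<subseteq> L i"
    using assms(4) by (metis proj_pointsE)
  have c'L: "c' \<in> L i" if "i \<in> {1..2*n+1}" for i
    using c'(2)[OF that] vec.span_base[of c' "{c'}"] by auto
  have card: "card (\<Union>i\<in>{1..2*n+1}. conic_on A (L i)) = 2 * card {1..2*n+1}"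
    using assms(5) by (simp add: conic_on_def)
  have "card {1..2*n+1} \<ge> 2" using assms(1) by simp
  note pencil = maximal_pencil[OF assms(2) finite_atLeastAtMost this _ _ c'(1) card]
  have c'_not_on_conic: "polar A c' c' \<noteq> 0" using pencil(1) assms(3) c'L by blast
  have not_tangent: "\<not> L i \<subseteq> polar_line A x"
    if "i \<in> {1..2*n+1}" "x \<noteq> 0" "polar A x x = 0" for i x
    using pencil(2) assms(3) c'L that by blast
  obtain e f k where k: "k \<noteq> 0" and frame: "polar_frame A e f (k *s c')"
    using polar_frame_exists[OF assms(2) c'_not_on_conic] by blast
  interpret polar_frame A e f "k *s c'" by (rule frame)

  have "\<exists>m. m \<noteq> 0 \<and> L i = mirror m" if i: "i \<in> {1..2*n+1}" for i
  proof -
    have "k *s c' \<in> L i"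
      using assms(3)[OF i] c'L[OF i] by (simp add: proj_lines_def vec.subspace_scale)
    then show ?thesis
      using nontangent_line_is_mirror[OF assms(3)[OF i] _ not_tangent[OF i]] by metis
  qed
  then obtain m0 where m0: "\<And>i. i \<in> {1..2*n+1} \<Longrightarrow> m0 i \<noteq> 0 \<and> L i = mirror (m0 i)" by metis
  \<comment> \<open>The parameters for both rounds; the lines repeat with period \<open>2 * n + 1\<close>.\<close>
  define m where "m i = m0 (if i \<le> 2*n+1 then i else i - (2*n+1))" for i
  have m: "m i \<noteq> 0 \<and> L i = mirror (m i)" if i: "i \<in> {1..4*n+2}" for i
  proof (cases "i \<le> 2*n+1")
    case True
    with i m0 show ?thesis by (simp add: m_def)
  next
    case False
    then have j: "i - (2*n+1) \<in> {1..2*n+1}" "i = 2*n+1 + (i - (2*n+1))" using i by auto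
    then have "L i = L (i - (2*n+1))" using assms(6)[OF j(1)] by simp
    then show ?thesis using m0[OF j(1)] False by (simp add: m_def)
  qed

  obtain x1 where x1: "x1 \<noteq> 0" "polar A x1 x1 = 0" "t 1 = polar_line A x1"
    using assms(9) by (auto simp: tangent_line_iff)
  \<comment> \<open>The point of contact of the other tangent through \<open>P 1\<close>, so that also \<open>t 1\<close> comes from a reflection.\<close>
  define x0 where "x0 = reflect (m 1) x1"
  have m1: "m 1 \<noteq> 0" "L 1 = mirror (m 1)" using m[of 1] by auto
  have x0: "x0 \<noteq> 0" "polar A x0 x0 = 0"
    using x1 m1 by (simp_all add: x0_def reflect_eq_0_iff polar_reflect)
  \<comment> \<open>The point of contact of \<open>t i\<close>; \<open>y (4 * n + 2)\<close> belongs to the second tangent from \<open>P (4 * n + 2)\<close>.\<close>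
  define y where "y i = fold reflect (map m [1..<Suc i]) x0" for i
  have y1: "y 1 = x1" using m1 by (simp add: y_def x0_def reflect_reflect)
  have y_Suc: "y (Suc i) = reflect (m (Suc i)) (y i)" for i by (simp add: y_def)
  have y: "y i \<noteq> 0" "polar A (y i) (y i) = 0" if "i \<le> 4*n+2" for i
  proof -
    have "0 \<notin> set (map m [1..<Suc i])"
      using m that by (force simp del: upt_Suc)
    from fold_reflect_isotropic[OF this x0] show "y i \<noteq> 0" "polar A (y i) (y i) = 0"
      by (simp_all add: y_def del: upt_Suc)
  qed
  have closing: "y (4*n+2) = x0"
  proof -
    define ms where "ms = map m [1..<2*n+2]"
    have "map m [1..<Suc (4*n+2)] = ms @ ms"
      by (rule nth_equalityI) (auto simp: ms_def m_def nth_append simp del: upt_Suc intro!: arg_cong[of _ _ m0])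
    moreover have "0 \<notin> set ms" using m by (force simp: ms_def simp del: upt_Suc)
    moreover have "odd (length ms)" by (simp add: ms_def)
    ultimately show ?thesis
      using odd_fold_reflect_involution[of ms x0] by (simp add: y_def del: upt_Suc)
  qed

  have inv: "P i \<in> proj_points \<and> P i \<subseteq> L i \<and> P i \<subseteq> polar_line A (y i)
      \<and> (i \<le> 4*n+1 \<longrightarrow> t i = polar_line A (y i))" if "1 \<le> i" "i \<le> 4*n+2" for i
    using that
  proof (induction i rule: dec_induct)
    case base
    show ?case using assms(7,8,10) x1(3) y1 by simp
  next
    case (step i)
    have i: "i \<in> {1..4*n+1}" using step by simp
    have ti: "t i = polar_line A (y i)" using step by simp
    have mi: "m (Suc i) \<noteq> 0" "L (Suc i) = mirror (m (Suc i))" using m[of "Suc i"] i by auto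
    have P: "P (Suc i) = polar_line A (y i) \<inter> mirror (m (Suc i))"
      using assms(12)[OF i] ti mi by simp
    have pp: "P (Suc i) \<in> proj_points"
      unfolding P using mi y[of i] i by (intro tangent_meets_mirror) auto
    moreover have "P (Suc i) \<subseteq> polar_line A (y (Suc i))"
      unfolding y_Suc using mi P by (intro mirror_point_on_reflect_tangent) auto
    moreover have "t (Suc i) = polar_line A (y (Suc i))" if "Suc i \<le> 4*n+1"
      using assms(11)[of "Suc i"] second_tangent_reflect[OF mi(1) y[of i] pp] i that P ti y_Suc[of i]
      by simp
    ultimately show ?case using mi P by simp
  qed

  have "tangent_line A (line_through (P 1) (P (4*n+2)))" if "P 1 \<noteq> P (4*n+2)"
  proof -
    have "P 1 \<subseteq> polar_line A x0"
      unfolding x0_def using m1 assms(8,10) x1(3) by (intro mirror_point_on_reflect_tangent) auto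
    moreover have "P (4*n+2) \<subseteq> polar_line A x0" using inv[of "4*n+2"] closing by simp
    ultimately have "line_through (P 1) (P (4*n+2)) = polar_line A x0"
      using inv[of "4*n+2"] assms(2,7) x0 that by (intro line_through_eq_polar_line) auto
    then show ?thesis using x0 by (auto simp: tangent_line_iff)
  qed
  moreover have "P j \<subseteq> L j \<and> P (2*n+1+j) \<subseteq> L j" if "j \<in> {1..2*n+1}" for j
    using inv[of j] inv[of "2*n+1+j"] assms(6)[OF that] that by auto
  ultimately show ?thesis using inv by auto
qed

end
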